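(* Let $(p,\mathcal{F}_p)$ denote the one-point semi-uniform space and let $G$ be an abelian group. Then $$H_n^{VR}(p;G)\cong H^n_{VR}(p;G)\cong\begin{cases} G & n=0\\ 0 & n>0.\end{cases}$$
   Context: A semi-uniform structure on a set $X$ is a filter $\mathcal{F}$ on $X\times X$ (a nonempty collection of subsets, not containing $\emptyset$, closed under finite intersections and supersets) such that every member contains the diagonal and, for every $U\in\mathcal{F}$, $U^{-1}=\{(y,x)\mid (x,y)\in U\}$ contains a member of $\mathcal{F}$. On a one-point set there is exactly one semi-uniform structure. For a relation $U\subset X\times X$, the Vietoris-Rips complex $\Sigma^X_U$ is the simplicial complex with vertex set $X$ in which a finite nonempty set is a simplex iff its elements can be ordered as $x_0,\dots,x_q$ (distinct) so that $(x_i,x_j)\in U$ for all $i<j$. For $U\subset U'$ in $\mathcal{F}$ the inclusion $\Sigma^X_U\subset\Sigma^X_{U'}$ induces maps on simplicial homology and cohomology, and one defines $H_*^{VR}(X;G)=\varprojlim_{U\in\mathcal{F}}H_*(\Sigma^X_U;G)$ and $H^*_{VR}(X;G)=\varinjlim_{U\in\mathcal{F}}H^*(\Sigma^X_U;G)$. *)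

theory Defs
  imports "HOL-Algebra.Product_Groups" "HOL-Algebra.FiniteProduct" "HOL-Combinatorics.Permutations"
begin

section \<open>Quotients, direct sums and limits of abelian groups\<close>

text \<open>
  For a homomorphism \<open>h\<close> into \<open>H\<close> which maps \<open>N'\<close> into \<open>N\<close>, this is the induced map
  from \<open>G Mod N'\<close> to \<open>H Mod N\<close>: a coset \<open>N' x\<close> is sent to \<open>N h(N' x) = N h(x)\<close>.
\<close>
definition quotient_map ::
    "('b, 'm) monoid_scheme \<Rightarrow> 'b set \<Rightarrow> ('a \<Rightarrow> 'b) \<Rightarrow> 'a set \<Rightarrow> 'b set" where
  "quotient_map H N h = (\<lambda>A. N <#>\<^bsub>H\<^esub> (h ` A))"

definition summand :: "'i set \<Rightarrow> ('i \<Rightarrow> ('b, 'm) monoid_scheme) \<Rightarrow> 'i \<Rightarrow> 'b \<Rightarrow> 'i \<Rightarrow> 'b" where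
  "summand I G i x = (\<lambda>j\<in>I. if j = i then x else \<one>\<^bsub>G j\<^esub>)"

text \<open>
  Limits of systems of abelian groups indexed by \<open>I\<close> with preorder \<open>r\<close>.
  In an inverse system, \<open>f j i\<close> maps \<open>G j\<close> to \<open>G i\<close> whenever \<open>r i j\<close>; in a direct
  system, \<open>f i j\<close> maps \<open>G i\<close> to \<open>G j\<close> whenever \<open>r i j\<close>.
\<close>
definition inverse_limit ::
    "'i set \<Rightarrow> ('i \<Rightarrow> 'i \<Rightarrow> bool) \<Rightarrow> ('i \<Rightarrow> ('b, 'm) monoid_scheme) \<Rightarrow>
      ('i \<Rightarrow> 'i \<Rightarrow> 'b \<Rightarrow> 'b) \<Rightarrow> ('i \<Rightarrow> 'b) monoid" where
  "inverse_limit I r G f =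
     (product_group I G)\<lparr>carrier :=
        {x \<in> carrier (product_group I G). \<forall>i\<in>I. \<forall>j\<in>I. r i j \<longrightarrow> f j i (x j) = x i}\<rparr>"

definition direct_limit ::
    "'i set \<Rightarrow> ('i \<Rightarrow> 'i \<Rightarrow> bool) \<Rightarrow> ('i \<Rightarrow> ('b, 'm) monoid_scheme) \<Rightarrow>
      ('i \<Rightarrow> 'i \<Rightarrow> 'b \<Rightarrow> 'b) \<Rightarrow> ('i \<Rightarrow> 'b) set monoid" where
  "direct_limit I r G f =
     sum_group I G Mod
       generate (sum_group I G)
         {summand I G i x \<otimes>\<^bsub>sum_group I G\<^esub> inv\<^bsub>sum_group I G\<^esub> (summand I G j (f i j x)) | i j x.
            i \<in> I \<and> j \<in> I \<and> r i j \<and> x \<in> carrier (G i)}"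


section \<open>Simplicial chains\<close>

text \<open>
  A simplicial complex is given by its set \<open>K\<close> of (finite nonempty) simplices.  Following the
  classical definition, oriented \<open>q\<close>-chains with coefficients in \<open>G\<close> are formal combinations of
  ordered simplices \<open>[v\<^sub>0, \<dots>, v\<^sub>q]\<close> with distinct vertices, modulo the relations which identify
  a reordering by a permutation \<open>\<pi>\<close> with the original simplex multiplied by \<open>sign \<pi>\<close>.
  Group operations are written multiplicatively, so this sign is an exponent.
\<close>
definition ordered_simplices :: "'a set set \<Rightarrow> nat \<Rightarrow> 'a list set" where
  "ordered_simplices K q = {v. distinct v \<and> length v = Suc q \<and> set v \<in> K}"

definition ordered_chains ::
    "'a set set \<Rightarrow> ('g, 'm) monoid_scheme \<Rightarrow> nat \<Rightarrow> ('a list \<Rightarrow> 'g) monoid" where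
  "ordered_chains K G q = sum_group (ordered_simplices K q) (\<lambda>_. G)"

definition elementary_chain ::
    "'a set set \<Rightarrow> ('g, 'm) monoid_scheme \<Rightarrow> nat \<Rightarrow> 'a list \<Rightarrow> 'g \<Rightarrow> 'a list \<Rightarrow> 'g" where
  "elementary_chain K G q = summand (ordered_simplices K q) (\<lambda>_. G)"

definition orientation_relations ::
    "'a set set \<Rightarrow> ('g, 'm) monoid_scheme \<Rightarrow> nat \<Rightarrow> ('a list \<Rightarrow> 'g) set" where
  "orientation_relations K G q =
     generate (ordered_chains K G q)
       {elementary_chain K G q (permute_list \<pi> v) g \<otimes>\<^bsub>ordered_chains K G q\<^esub>
          inv\<^bsub>ordered_chains K G q\<^esub> (elementary_chain K G q v (g [^]\<^bsub>G\<^esub> sign \<pi>)) | \<pi> v g.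
          v \<in> ordered_simplices K q \<and> \<pi> permutes {..<Suc q} \<and> g \<in> carrier G}"

definition chain_group ::
    "'a set set \<Rightarrow> ('g, 'm) monoid_scheme \<Rightarrow> nat \<Rightarrow> ('a list \<Rightarrow> 'g) set monoid" where
  "chain_group K G q = ordered_chains K G q Mod orientation_relations K G q"

definition face :: "nat \<Rightarrow> 'a list \<Rightarrow> 'a list" where
  "face i v = take i v @ drop (Suc i) v"

text \<open>
  The boundary operators carry the index of their codomain, \<open>\<partial> : C\<^bsub>q+1\<^esub> \<rightarrow> C\<^sub>q\<close>. On formal
  combinations, \<open>\<Sum>\<^sub>v c\<^sub>v v\<close> is sent to \<open>\<Sum>\<^sub>v \<Sum>\<^sub>i (-1)\<^sup>i c\<^sub>v [v\<^sub>0, \<dots>, v\<^bsub>i-1\<^esub>, v\<^bsub>i+1\<^esub>, \<dots>, v\<^bsub>q+1\<^esub>]\<close>.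
\<close>
definition ordered_boundary ::
    "'a set set \<Rightarrow> ('g, 'm) monoid_scheme \<Rightarrow> nat \<Rightarrow> ('a list \<Rightarrow> 'g) \<Rightarrow> ('a list \<Rightarrow> 'g)" where
  "ordered_boundary K G q c =
     (\<Otimes>\<^bsub>ordered_chains K G q\<^esub> v \<in> {v \<in> ordered_simplices K (Suc q). c v \<noteq> \<one>\<^bsub>G\<^esub>}.
        \<Otimes>\<^bsub>ordered_chains K G q\<^esub> i \<in> {..Suc q}.
          elementary_chain K G q (face i v) (c v [^]\<^bsub>G\<^esub> ((-1::int) ^ i)))"

definition boundary ::
    "'a set set \<Rightarrow> ('g, 'm) monoid_scheme \<Rightarrow> nat \<Rightarrow> ('a list \<Rightarrow> 'g) set \<Rightarrow> ('a list \<Rightarrow> 'g) set" where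
  "boundary K G q =
     quotient_map (ordered_chains K G q) (orientation_relations K G q) (ordered_boundary K G q)"

text \<open>The chain map induced by an inclusion of complexes \<open>K \<subseteq> L\<close>.\<close>
definition chain_inclusion ::
    "'a set set \<Rightarrow> 'a set set \<Rightarrow> ('g, 'm) monoid_scheme \<Rightarrow> nat \<Rightarrow>
      ('a list \<Rightarrow> 'g) set \<Rightarrow> ('a list \<Rightarrow> 'g) set" where
  "chain_inclusion K L G q =
     quotient_map (ordered_chains L G q) (orientation_relations L G q)
       (\<lambda>c. \<lambda>v\<in>ordered_simplices L q. if v \<in> ordered_simplices K q then c v else \<one>\<^bsub>G\<^esub>)"


section \<open>Simplicial homology\<close>

definition cycle_group ::
    "'a set set \<Rightarrow> ('g, 'm) monoid_scheme \<Rightarrow> nat \<Rightarrow> ('a list \<Rightarrow> 'g) set monoid" where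
  "cycle_group K G q =
     (chain_group K G q)\<lparr>carrier :=
        (case q of 0 \<Rightarrow> carrier (chain_group K G 0)
         | Suc m \<Rightarrow> kernel (chain_group K G (Suc m)) (chain_group K G m) (boundary K G m))\<rparr>"

definition boundaries ::
    "'a set set \<Rightarrow> ('g, 'm) monoid_scheme \<Rightarrow> nat \<Rightarrow> ('a list \<Rightarrow> 'g) set set" where
  "boundaries K G q = boundary K G q ` carrier (chain_group K G (Suc q))"

definition simplicial_homology ::
    "'a set set \<Rightarrow> ('g, 'm) monoid_scheme \<Rightarrow> nat \<Rightarrow> ('a list \<Rightarrow> 'g) set set monoid" where
  "simplicial_homology K G q = cycle_group K G q Mod boundaries K G q"

definition homology_inclusion ::
    "'a set set \<Rightarrow> 'a set set \<Rightarrow> ('g, 'm) monoid_scheme \<Rightarrow> nat \<Rightarrow>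
      ('a list \<Rightarrow> 'g) set set \<Rightarrow> ('a list \<Rightarrow> 'g) set set" where
  "homology_inclusion K L G q =
     quotient_map (cycle_group L G q) (boundaries L G q) (chain_inclusion K L G q)"


section \<open>Simplicial cohomology\<close>

text \<open>
  \<open>C\<^sup>q(K; G) = Hom(C\<^sub>q(K; \<int>), G)\<close>; homomorphisms are taken to be extensional functions, so that
  equality in the cochain group is equality on chains.
\<close>
definition cochain_group ::
    "'a set set \<Rightarrow> ('g, 'm) monoid_scheme \<Rightarrow> nat \<Rightarrow> (('a list \<Rightarrow> int) set \<Rightarrow> 'g) monoid" where
  "cochain_group K G q =
     \<lparr>carrier = hom (chain_group K integer_group q) G
                  \<inter> extensional (carrier (chain_group K integer_group q)),
      monoid.mult = (\<lambda>\<phi> \<psi>. \<lambda>c\<in>carrier (chain_group K integer_group q). \<phi> c \<otimes>\<^bsub>G\<^esub> \<psi> c),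
      one = (\<lambda>c\<in>carrier (chain_group K integer_group q). \<one>\<^bsub>G\<^esub>)\<rparr>"

definition coboundary ::
    "'a set set \<Rightarrow> nat \<Rightarrow> (('a list \<Rightarrow> int) set \<Rightarrow> 'g) \<Rightarrow> (('a list \<Rightarrow> int) set \<Rightarrow> 'g)" where
  "coboundary K q \<phi> =
     (\<lambda>c\<in>carrier (chain_group K integer_group (Suc q)). \<phi> (boundary K integer_group q c))"

definition cocycle_group ::
    "'a set set \<Rightarrow> ('g, 'm) monoid_scheme \<Rightarrow> nat \<Rightarrow> (('a list \<Rightarrow> int) set \<Rightarrow> 'g) monoid" where
  "cocycle_group K G q =
     (cochain_group K G q)\<lparr>carrier :=
        kernel (cochain_group K G q) (cochain_group K G (Suc q)) (coboundary K q)\<rparr>"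

definition coboundaries ::
    "'a set set \<Rightarrow> ('g, 'm) monoid_scheme \<Rightarrow> nat \<Rightarrow> (('a list \<Rightarrow> int) set \<Rightarrow> 'g) set" where
  "coboundaries K G q =
     (case q of 0 \<Rightarrow> {\<one>\<^bsub>cochain_group K G 0\<^esub>}
      | Suc m \<Rightarrow> coboundary K m ` carrier (cochain_group K G m))"

definition simplicial_cohomology ::
    "'a set set \<Rightarrow> ('g, 'm) monoid_scheme \<Rightarrow> nat \<Rightarrow> (('a list \<Rightarrow> int) set \<Rightarrow> 'g) set monoid" where
  "simplicial_cohomology K G q = cocycle_group K G q Mod coboundaries K G q"

text \<open>The contravariant map \<open>H\<^sup>q(L; G) \<rightarrow> H\<^sup>q(K; G)\<close> induced by an inclusion of complexes \<open>K \<subseteq> L\<close>.\<close>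
definition cohomology_restriction ::
    "'a set set \<Rightarrow> 'a set set \<Rightarrow> ('g, 'm) monoid_scheme \<Rightarrow> nat \<Rightarrow>
      (('a list \<Rightarrow> int) set \<Rightarrow> 'g) set \<Rightarrow> (('a list \<Rightarrow> int) set \<Rightarrow> 'g) set" where
  "cohomology_restriction K L G q =
     quotient_map (cocycle_group K G q) (coboundaries K G q)
       (\<lambda>\<phi>. \<lambda>c\<in>carrier (chain_group K integer_group q). \<phi> (chain_inclusion K L integer_group q c))"


section \<open>Semi-uniform spaces and Vietoris-Rips (co)homology\<close>

definition semi_uniform_structure :: "'a set \<Rightarrow> ('a \<times> 'a) set set \<Rightarrow> bool" where
  "semi_uniform_structure X F \<longleftrightarrow>
     F \<subseteq> Pow (X \<times> X) \<and> F \<noteq> {} \<and> {} \<notin> F \<and>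
     (\<forall>U\<in>F. \<forall>V\<in>F. U \<inter> V \<in> F) \<and>
     (\<forall>U\<in>F. \<forall>V. U \<subseteq> V \<and> V \<subseteq> X \<times> X \<longrightarrow> V \<in> F) \<and>
     (\<forall>U\<in>F. Id_on X \<subseteq> U) \<and>
     (\<forall>U\<in>F. \<exists>V\<in>F. V \<subseteq> converse U)"

definition VR_complex :: "'a set \<Rightarrow> ('a \<times> 'a) set \<Rightarrow> 'a set set" where
  "VR_complex X U =
     {set xs | xs. xs \<noteq> [] \<and> distinct xs \<and> set xs \<subseteq> X \<and> sorted_wrt (\<lambda>x y. (x, y) \<in> U) xs}"

text \<open>
  The index set \<open>F\<close> is directed by reverse inclusion: \<open>V\<close> is beyond \<open>U\<close> when \<open>V \<subseteq> U\<close>.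
\<close>
definition VR_homology ::
    "'a set \<Rightarrow> ('a \<times> 'a) set set \<Rightarrow> ('g, 'm) monoid_scheme \<Rightarrow> nat \<Rightarrow>
      (('a \<times> 'a) set \<Rightarrow> ('a list \<Rightarrow> 'g) set set) monoid" where
  "VR_homology X F G n =
     inverse_limit F (\<lambda>U V. V \<subseteq> U)
       (\<lambda>U. simplicial_homology (VR_complex X U) G n)
       (\<lambda>V U. homology_inclusion (VR_complex X V) (VR_complex X U) G n)"

definition VR_cohomology ::
    "'a set \<Rightarrow> ('a \<times> 'a) set set \<Rightarrow> ('g, 'm) monoid_scheme \<Rightarrow> nat \<Rightarrow>
      (('a \<times> 'a) set \<Rightarrow> (('a list \<Rightarrow> int) set \<Rightarrow> 'g) set) set monoid" where
  "VR_cohomology X F G n =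
     direct_limit F (\<lambda>U V. V \<subseteq> U)
       (\<lambda>U. simplicial_cohomology (VR_complex X U) G n)
       (\<lambda>U V. cohomology_restriction (VR_complex X V) (VR_complex X U) G n)"

end

theory Submission
  imports Defs
begin

text \<open>The only entourage of the one-point space is \<open>{(p, p)}\<close>, so both limits run over a single index
  and are the (co)homology of the complex \<open>{{p}}\<close>. It has one ordered simplex, in degree 0, on which
  the orientation relations are vacuous: the chain group is \<open>G\<close> in degree 0 and trivial above.\<close>

section \<open>Quotients and limits\<close>

text \<open>On the one-point complex every quotient in the construction (orientation relations,
  boundaries, coboundaries, direct limit) is by the trivial subgroup, so up to isomorphism it
  changes nothing.\<close>

lemma group_Mod_one:
  assumes "group G"
  shows "group (G Mod {\<one>\<^bsub>G\<^esub>})" "G Mod {\<one>\<^bsub>G\<^esub>} \<cong> G"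
  using normal.factorgroup_is_group[OF group.one_is_normal[OF assms]]
    group.trivial_factor_iso[OF assms] is_isoI
  by auto

text \<open>An inclusion rather than an equality, because the set of relators can be empty, as for
  the orientation relators in positive degree.\<close>

lemma generate_subset_one:
  assumes "group G" "S \<subseteq> {\<one>\<^bsub>G\<^esub>}"
  shows "generate G S = {\<one>\<^bsub>G\<^esub>}"
  using subset_singletonD[OF assms(2)] group.generate_one[OF assms(1)] group.generate_empty[OF assms(1)]
  by auto

lemma carrier_Mod_one:
  assumes "group G"
  shows "carrier (G Mod {\<one>\<^bsub>G\<^esub>}) = (\<lambda>x. {x}) ` carrier G"
proof -
  interpret group G by fact
  show ?thesis
    by (auto simp: carrier_FactGroup r_coset_def)
qed

lemma trivial_groups_iso:
  assumes "trivial_group G" "trivial_group H"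
  shows "G \<cong> H"
proof -
  have "(\<lambda>_. \<one>\<^bsub>H\<^esub>) \<in> iso G H"
    using assms group.is_monoid[of H] monoid.l_one[of H "\<one>\<^bsub>H\<^esub>"]
    by (auto simp: iso_def hom_def bij_betw_def trivial_group_def)
  then show ?thesis
    by (rule is_isoI)
qed

text \<open>A coset of \<open>N\<close> absorbs multiplication by \<open>N\<close>. This handles the
  self-inclusion of the point at the level of chains, homology and cohomology alike; there
  \<open>h\<close> fixes elements of the carrier, while its values elsewhere are arbitrary.\<close>

lemma quotient_map_id:
  assumes "N \<lhd> H" "\<And>x. x \<in> carrier H \<Longrightarrow> h x = x" "A \<in> carrier (H Mod N)"
  shows "quotient_map H N h A = A"
proof -
  interpret normal N H by fact
  have A: "A \<in> rcosets\<^bsub>H\<^esub> N"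
    using assms(3) by (simp add: FactGroup_def)
  then have "A \<subseteq> carrier H"
    using rcosets_part_G[OF is_subgroup] by blast
  then have "h ` A = (\<lambda>x. x) ` A"
    using assms(2) by (intro image_cong) auto
  then show ?thesis
    using rcosets_mult_eq[OF A] by (simp add: quotient_map_def)
qed

section \<open>Products, sums and limits over a one-element index set\<close>

lemma product_group_singleton_iso: "product_group {i} G \<cong> G i"
proof -
  have "bij_betw (\<lambda>x. x i) (\<Pi>\<^sub>E j\<in>{i}. carrier (G j)) (carrier (G i))"
  proof (rule bij_betwI[where g = "\<lambda>a. \<lambda>j\<in>{i}. a"])
    show "(\<lambda>j\<in>{i}. x i) = x" if "x \<in> (\<Pi>\<^sub>E j\<in>{i}. carrier (G j))" for x
      using that by (intro ext) (auto simp: PiE_iff extensional_def)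
  qed auto
  then have "(\<lambda>x. x i) \<in> iso (product_group {i} G) (G i)"
    by (auto simp: iso_def hom_def PiE_iff)
  then show ?thesis
    by (rule is_isoI)
qed

lemma sum_group_singleton:
  assumes "group (G i)"
  shows "sum_group {i} G \<cong> G i"
proof -
  have "carrier (sum_group {i} G) = carrier (product_group {i} G)"
    using assms carrier_sum_group[of "{i}" G] by auto
  then have "sum_group {i} G = product_group {i} G"
    by (intro monoid.equality) simp_all
  then show ?thesis
    by (simp add: product_group_singleton_iso)
qed

text \<open>Compatibility concerns only the pair \<open>(i, i)\<close>, where \<open>f i i\<close>
  is the identity, so the inverse limit is the whole product.\<close>

lemma inverse_limit_singleton:
  assumes "\<And>x. x \<in> carrier (G i) \<Longrightarrow> f i i x = x"
  shows "inverse_limit {i} r G f \<cong> G i"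
proof -
  have "inverse_limit {i} r G f = product_group {i} G"
    using assms by (auto simp: inverse_limit_def PiE_iff intro!: monoid.equality)
  then show ?thesis
    by (simp add: product_group_singleton_iso)
qed

text \<open>Each relator compares \<open>x\<close> with \<open>f i i x = x\<close> and is therefore
  the unit. The group property is recorded because reversing an isomorphism out of the limit
  requires it.\<close>

lemma direct_limit_singleton:
  assumes "group (G i)" "\<And>x. x \<in> carrier (G i) \<Longrightarrow> f i i x = x"
  shows "group (direct_limit {i} r G f)" "direct_limit {i} r G f \<cong> G i"
proof -
  let ?S = "sum_group {i} G"
  have S: "group ?S"
    using assms(1) by (intro sum_group) auto
  let ?R = "{summand {i} G k x \<otimes>\<^bsub>?S\<^esub> inv\<^bsub>?S\<^esub> (summand {i} G j (f k j x)) | k j x.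
            k \<in> {i} \<and> j \<in> {i} \<and> r k j \<and> x \<in> carrier (G k)}"
  have closed: "summand {i} G i x \<in> carrier ?S" if "x \<in> carrier (G i)" for x
    using that assms(1) carrier_sum_group[of "{i}" G] by (auto simp: summand_def)
  have "y = \<one>\<^bsub>?S\<^esub>" if y_mem: "y \<in> ?R" for y
  proof -
    obtain x where "y = summand {i} G i x \<otimes>\<^bsub>?S\<^esub> inv\<^bsub>?S\<^esub> (summand {i} G i (f i i x))"
      and x: "x \<in> carrier (G i)"
      using y_mem by blast
    then have "y = summand {i} G i x \<otimes>\<^bsub>?S\<^esub> inv\<^bsub>?S\<^esub> (summand {i} G i x)"
      by (simp only: assms(2))
    then show ?thesis
      using group.r_inv[OF S closed[OF x]] by (rule trans)
  qed
  then have "?R \<subseteq> {\<one>\<^bsub>?S\<^esub>}"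
    by blast
  then have "generate ?S ?R = {\<one>\<^bsub>?S\<^esub>}"
    by (rule generate_subset_one[OF S])
  then have *: "direct_limit {i} r G f = ?S Mod {\<one>\<^bsub>?S\<^esub>}"
    unfolding direct_limit_def by simp
  show "group (direct_limit {i} r G f)"
    unfolding * by (rule group_Mod_one(1)[OF S])
  show "direct_limit {i} r G f \<cong> G i"
    unfolding * by (rule iso_trans[OF group_Mod_one(2)[OF S] sum_group_singleton[of G i, OF assms(1)]])
qed


section \<open>The complex with a single vertex\<close>

lemma ordered_simplices_point:
  "ordered_simplices {{p}} 0 = {[p]}" "ordered_simplices {{p}} (Suc q) = {}"
proof -
  have "v = [p]" if "v \<in> ordered_simplices {{p}} 0" for v
  proof -
    from that have "length v = Suc 0" and "set v = {p}"
      by (simp_all add: ordered_simplices_def)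
    then show ?thesis
      by (cases v) simp_all
  qed
  moreover have "[p] \<in> ordered_simplices {{p}} 0"
    by (simp add: ordered_simplices_def)
  ultimately show "ordered_simplices {{p}} 0 = {[p]}"
    by blast
  show "ordered_simplices {{p}} (Suc q) = {}"
  proof -
    have False if "v \<in> ordered_simplices {{p}} (Suc q)" for v
      \<comment> \<open>A distinct list with vertex set \<open>{p}\<close> has length 1, whereas
        degree \<open>Suc q\<close> asks for length \<open>q + 2\<close>.\<close>
      using that distinct_card[of v] by (simp add: ordered_simplices_def)
    then show ?thesis
      by blast
  qed
qed

section \<open>Chain groups of the point and the maps between them\<close>

lemma group_ordered_chains: "group G \<Longrightarrow> group (ordered_chains K G q)"
  by (simp add: ordered_chains_def)

text \<open>In positive degree there is no simplex to reorder. In degree 0 the only permutation of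
  the single position is the identity, of sign 1, so each relator has the form \<open>x\<close>
  times the inverse of \<open>x\<close>.\<close>

lemma orientation_relations_point:
  assumes "group G"
  shows "orientation_relations {{p}} G q = {\<one>\<^bsub>ordered_chains {{p}} G q\<^esub>}"
proof -
  let ?C = "ordered_chains {{p}} G q"
  interpret group G by fact
  interpret C: group ?C
    using assms by (rule group_ordered_chains)
  let ?R = "{elementary_chain {{p}} G q (permute_list \<pi> v) g \<otimes>\<^bsub>?C\<^esub>
          inv\<^bsub>?C\<^esub> (elementary_chain {{p}} G q v (g [^]\<^bsub>G\<^esub> sign \<pi>)) | \<pi> v g.
          v \<in> ordered_simplices {{p}} q \<and> \<pi> permutes {..<Suc q} \<and> g \<in> carrier G}"
  have "x = \<one>\<^bsub>?C\<^esub>" if x_mem: "x \<in> ?R" for x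
  proof -
    obtain \<pi> v g where x: "x = elementary_chain {{p}} G q (permute_list \<pi> v) g \<otimes>\<^bsub>?C\<^esub>
          inv\<^bsub>?C\<^esub> (elementary_chain {{p}} G q v (g [^]\<^bsub>G\<^esub> sign \<pi>))"
      and v: "v \<in> ordered_simplices {{p}} q" and \<pi>: "\<pi> permutes {..<Suc q}" and g: "g \<in> carrier G"
      using x_mem by blast
    have q: "q = 0"
      using v by (cases q) (auto simp: ordered_simplices_point)
    then have "\<pi> = id"
      using \<pi> by (simp add: lessThan_Suc)
    then have "x = elementary_chain {{p}} G q v g \<otimes>\<^bsub>?C\<^esub> inv\<^bsub>?C\<^esub> (elementary_chain {{p}} G q v g)"
      using g by (simp add: x sign_id int_pow_1)
    moreover have "elementary_chain {{p}} G q v g \<in> carrier ?C"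
      using g v q assms
      by (auto simp: elementary_chain_def summand_def ordered_chains_def carrier_sum_group
          ordered_simplices_point)
    ultimately show ?thesis
      by (simp only: C.r_inv)
  qed
  then have "?R \<subseteq> {\<one>\<^bsub>?C\<^esub>}"
    by blast
  then show ?thesis
    unfolding orientation_relations_def by (rule generate_subset_one[OF C.is_group])
qed

lemma chain_group_point:
  "group G \<Longrightarrow> chain_group {{p}} G q = ordered_chains {{p}} G q Mod {\<one>\<^bsub>ordered_chains {{p}} G q\<^esub>}"
  by (simp add: chain_group_def orientation_relations_point)

lemma group_chain_group_point: "group G \<Longrightarrow> group (chain_group {{p}} G q)"
  by (simp add: chain_group_point group_Mod_one group_ordered_chains)

lemma chain_group_point_0:
  assumes "group G"
  shows "chain_group {{p}} G 0 \<cong> G"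
proof -
  have "ordered_chains {{p}} G 0 \<cong> G"
    using sum_group_singleton[of "\<lambda>_. G"] assms
    by (simp add: ordered_chains_def ordered_simplices_point)
  then show ?thesis
    using group_Mod_one(2)[OF group_ordered_chains[OF assms]] iso_trans
    by (metis chain_group_point[OF assms])
qed

lemma trivial_chain_group_point_Suc:
  assumes "group G"
  shows "trivial_group (chain_group {{p}} G (Suc q))"
proof -
  have "trivial_group (ordered_chains {{p}} G (Suc q))"
    using assms group_ordered_chains[OF assms, of "{{p}}" "Suc q"]
    by (auto simp: trivial_group_def ordered_chains_def ordered_simplices_point carrier_sum_group)
  then show ?thesis
    using group_chain_group_point[OF assms, of p "Suc q"]
    by (auto simp: trivial_group_def chain_group_point assms carrier_Mod_one)
qed

text \<open>The source degree is \<open>Suc q\<close>, where there are no simplices, so the outer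
  product defining the boundary is empty.\<close>

lemma boundary_point:
  assumes "group G" "c \<in> carrier (chain_group {{p}} G (Suc q))"
  shows "boundary {{p}} G q c = \<one>\<^bsub>chain_group {{p}} G q\<^esub>"
proof -
  let ?C = "ordered_chains {{p}} G q"
  interpret C: group ?C
    using assms(1) by (rule group_ordered_chains)
  have "ordered_boundary {{p}} G q x = \<one>\<^bsub>?C\<^esub>" for x
    by (simp add: ordered_boundary_def ordered_simplices_point finprod_def)
  \<comment> \<open>Cosets of the trivial subgroup are singletons, so the induced map is computed on
    one representative.\<close>
  moreover obtain x where "c = {x}"
    using assms by (auto simp: chain_group_point carrier_Mod_one group_ordered_chains)
  ultimately show ?thesis
    by (simp add: boundary_def quotient_map_def orientation_relations_point set_mult_def
        chain_group_point assms(1))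
qed

lemma chain_inclusion_point:
  assumes "group G" "c \<in> carrier (chain_group {{p}} G q)"
  shows "chain_inclusion {{p}} {{p}} G q c = c"
  unfolding chain_inclusion_def
proof (rule quotient_map_id)
  show "orientation_relations {{p}} G q \<lhd> ordered_chains {{p}} G q"
    using group.one_is_normal[OF group_ordered_chains[OF assms(1)]]
    by (simp add: orientation_relations_point assms(1))
  show "c \<in> carrier (ordered_chains {{p}} G q Mod orientation_relations {{p}} G q)"
    using assms(2) by (simp add: chain_group_def)
  fix c assume "c \<in> carrier (ordered_chains {{p}} G q)"
  then have "c \<in> extensional (ordered_simplices {{p}} q)"
    using assms(1) by (simp add: ordered_chains_def carrier_sum_group PiE_iff)
  then show "(\<lambda>v\<in>ordered_simplices {{p}} q. if v \<in> ordered_simplices {{p}} q then c v else \<one>\<^bsub>G\<^esub>) = c"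
    by (auto simp: extensional_def)
qed


section \<open>Homology of the point\<close>

lemma boundaries_point:
  assumes "group G"
  shows "boundaries {{p}} G q = {\<one>\<^bsub>chain_group {{p}} G q\<^esub>}"
  using trivial_chain_group_point_Suc[OF assms, of p q] boundary_point[OF assms, of _ p q]
  by (auto simp: boundaries_def trivial_group_def)

text \<open>Every chain is a cycle: by definition in degree 0, and by the vanishing of the boundary
  above.\<close>

lemma cycle_group_point:
  assumes "group G"
  shows "cycle_group {{p}} G q = chain_group {{p}} G q"
  using trivial_chain_group_point_Suc[OF assms, of p] boundary_point[OF assms, of _ p]
  by (cases q) (auto simp: cycle_group_def kernel_def trivial_group_def intro!: monoid.equality)

lemma simplicial_homology_point:
  assumes "group G"
  shows "simplicial_homology {{p}} G q \<cong> chain_group {{p}} G q"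
  using group_Mod_one[OF group_chain_group_point[OF assms]]
  by (simp add: simplicial_homology_def cycle_group_point boundaries_point assms)

lemma homology_inclusion_point:
  assumes "group G" "A \<in> carrier (simplicial_homology {{p}} G q)"
  shows "homology_inclusion {{p}} {{p}} G q A = A"
  unfolding homology_inclusion_def
proof (rule quotient_map_id)
  show "boundaries {{p}} G q \<lhd> cycle_group {{p}} G q"
    using group.one_is_normal[OF group_chain_group_point[OF assms(1)]]
    by (simp add: boundaries_point cycle_group_point assms(1))
  show "A \<in> carrier (cycle_group {{p}} G q Mod boundaries {{p}} G q)"
    using assms(2) by (simp add: simplicial_homology_def)
qed (use assms in \<open>simp add: cycle_group_point chain_inclusion_point\<close>)


section \<open>Cohomology of the point\<close>

lemma mem_cochain_group:
  "\<phi> \<in> carrier (cochain_group K G q) \<longleftrightarrow>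
     \<phi> \<in> hom (chain_group K integer_group q) G \<and> \<phi> \<in> extensional (carrier (chain_group K integer_group q))"
  by (simp add: cochain_group_def)

text \<open>Commutativity of \<open>G\<close> is what makes pointwise products and pointwise
  inverses of homomorphisms homomorphisms again.\<close>

lemma group_cochain_group:
  assumes "comm_group G" "group (chain_group K integer_group q)"
  shows "group (cochain_group K G q)"
proof -
  interpret comm_group G by fact
  interpret C: group "chain_group K integer_group q" by fact
  let ?C = "carrier (chain_group K integer_group q)"
  show ?thesis
  proof (rule groupI)
    fix \<phi> assume \<phi>: "\<phi> \<in> carrier (cochain_group K G q)"
    show "\<exists>\<psi>\<in>carrier (cochain_group K G q). \<psi> \<otimes>\<^bsub>cochain_group K G q\<^esub> \<phi> = \<one>\<^bsub>cochain_group K G q\<^esub>"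
      by (rule bexI[of _ "\<lambda>c\<in>?C. inv\<^bsub>G\<^esub> (\<phi> c)"])
        (use \<phi> in \<open>auto simp: cochain_group_def hom_def Pi_iff inv_mult intro!: restrict_ext\<close>)
    show "\<one>\<^bsub>cochain_group K G q\<^esub> \<otimes>\<^bsub>cochain_group K G q\<^esub> \<phi> = \<phi>"
      using \<phi> by (auto simp: cochain_group_def hom_def Pi_iff extensional_def fun_eq_iff)
  next
    fix \<phi> \<psi> assume "\<phi> \<in> carrier (cochain_group K G q)" "\<psi> \<in> carrier (cochain_group K G q)"
    then show "\<phi> \<otimes>\<^bsub>cochain_group K G q\<^esub> \<psi> \<in> carrier (cochain_group K G q)"
      by (auto simp: cochain_group_def hom_def Pi_iff m_ac)
  next
    fix \<phi> \<psi> \<chi>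
    assume "\<phi> \<in> carrier (cochain_group K G q)" "\<psi> \<in> carrier (cochain_group K G q)"
      "\<chi> \<in> carrier (cochain_group K G q)"
    then show "\<phi> \<otimes>\<^bsub>cochain_group K G q\<^esub> \<psi> \<otimes>\<^bsub>cochain_group K G q\<^esub> \<chi> =
        \<phi> \<otimes>\<^bsub>cochain_group K G q\<^esub> (\<psi> \<otimes>\<^bsub>cochain_group K G q\<^esub> \<chi>)"
      by (auto simp: cochain_group_def hom_def Pi_iff m_assoc intro!: restrict_ext)
  qed (auto simp: cochain_group_def hom_def)
qed

text \<open>A homomorphism out of an infinite cyclic group is determined by the image of a generator,
  which can be prescribed freely.\<close>
lemma cochain_group_infinite_cyclic:
  assumes "comm_group G" "group (chain_group K integer_group q)"
    "chain_group K integer_group q \<cong> integer_group"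
  shows "cochain_group K G q \<cong> G"
proof -
  interpret comm_group G by fact
  interpret C: group "chain_group K integer_group q" by fact
  let ?A = "chain_group K integer_group q"
  obtain d where d: "d \<in> iso ?A integer_group"
    using assms(3) by (auto simp: is_iso_def)
  \<comment> \<open>The inverse of the isomorphism \<open>d\<close> onto the integers;
    \<open>e 1\<close> is the generator at which cochains will be evaluated.\<close>
  define e where "e = inv_into (carrier ?A) d"
  have bij: "bij_betw d (carrier ?A) UNIV"
    using d by (simp add: iso_def)
  have de: "d (e k) = k" and e: "e k \<in> carrier ?A" for k
    using bij unfolding e_def bij_betw_def by (auto simp: f_inv_into_f inv_into_into)
  have ed: "e (d c) = c" if "c \<in> carrier ?A" for c
    using bij that unfolding e_def bij_betw_def by auto
  have d_hom: "d (b \<otimes>\<^bsub>?A\<^esub> c) = d b + d c" if "b \<in> carrier ?A" "c \<in> carrier ?A" for b c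
    using d that by (simp add: iso_def hom_def)
  have e_hom: "e \<in> hom integer_group ?A"
    using C.iso_set_sym[OF d] by (simp add: iso_def e_def)
  have pow: "\<phi> c = \<phi> (e 1) [^]\<^bsub>G\<^esub> d c" if "\<phi> \<in> hom ?A G" "c \<in> carrier ?A" for \<phi> c
  proof -
    interpret \<phi>: group_hom ?A G \<phi>
      using that by unfold_locales
    interpret e: group_hom integer_group ?A e
      using e_hom by (simp add: group_hom_def group_hom_axioms_def C.is_group)
    \<comment> \<open>In the additive group of integers the power of 1 with exponent
      \<open>d c\<close> is \<open>d c\<close> itself, and \<open>e\<close> preserves
      powers.\<close>
    have "e (d c) = e 1 [^]\<^bsub>?A\<^esub> d c"
      using e.hom_int_pow[of 1 "d c"] by simp
    then show ?thesis
      using \<phi>.hom_int_pow[of "e 1" "d c"] ed[OF that(2)] e by simp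
  qed
  \<comment> \<open>Evaluation at the generator is inverted by sending \<open>g\<close> to the
    homomorphism \<open>c\<close> to \<open>g\<close> raised to \<open>d c\<close>, restricted to
    the carrier so that it is extensional.\<close>
  have "(\<lambda>\<phi>. \<phi> (e 1)) \<in> iso (cochain_group K G q) G"
    unfolding iso_def
  proof (intro CollectI conjI bij_betwI[where g = "\<lambda>g. \<lambda>c\<in>carrier ?A. g [^]\<^bsub>G\<^esub> d c"])
    show "(\<lambda>\<phi>. \<phi> (e 1)) \<in> hom (cochain_group K G q) G"
      using e by (auto simp: hom_def cochain_group_def)
    then show "(\<lambda>\<phi>. \<phi> (e 1)) \<in> carrier (cochain_group K G q) \<rightarrow> carrier G"
      by (simp add: hom_def)
    show "(\<lambda>g. \<lambda>c\<in>carrier ?A. g [^]\<^bsub>G\<^esub> d c) \<in> carrier G \<rightarrow> carrier (cochain_group K G q)"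
      by (auto simp: mem_cochain_group hom_def d_hom int_pow_mult)
    show "(\<lambda>c\<in>carrier ?A. \<phi> (e 1) [^]\<^bsub>G\<^esub> d c) = \<phi>" if "\<phi> \<in> carrier (cochain_group K G q)" for \<phi>
      using that pow by (auto simp: mem_cochain_group extensional_def fun_eq_iff)
    show "(\<lambda>c\<in>carrier ?A. g [^]\<^bsub>G\<^esub> d c) (e 1) = g" if "g \<in> carrier G" for g
      using that by (simp add: e de int_pow_1)
  qed
  then show ?thesis
    by (rule is_isoI)
qed

section \<open>Cochains, cocycles and coboundaries of the point\<close>

lemma group_cochain_group_point: "comm_group G \<Longrightarrow> group (cochain_group {{p}} G q)"
  by (intro group_cochain_group group_chain_group_point) auto

lemma cochain_group_point_0: "comm_group G \<Longrightarrow> cochain_group {{p}} G 0 \<cong> G"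
  by (intro cochain_group_infinite_cyclic group_chain_group_point chain_group_point_0) auto

lemma cochain_point_one:
  assumes "comm_group G" "\<phi> \<in> carrier (cochain_group {{p}} G q)"
  shows "\<phi> \<one>\<^bsub>chain_group {{p}} integer_group q\<^esub> = \<one>\<^bsub>G\<^esub>"
proof (rule hom_one)
  show "\<phi> \<in> hom (chain_group {{p}} integer_group q) G"
    using assms(2) by (simp add: mem_cochain_group)
  show "group G"
    using assms(1) by (rule comm_group.axioms)
qed (simp add: group_chain_group_point)

text \<open>A homomorphism out of a trivial group is determined on its only element, and
  extensionality fixes its values elsewhere.\<close>

lemma trivial_cochain_group_point_Suc:
  assumes "comm_group G"
  shows "trivial_group (cochain_group {{p}} G (Suc q))"
proof -
  have triv: "carrier (chain_group {{p}} integer_group (Suc q)) = {\<one>\<^bsub>chain_group {{p}} integer_group (Suc q)\<^esub>}"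
    using trivial_chain_group_point_Suc[OF group_integer_group] unfolding trivial_group_def by (rule conjunct2)
  have "\<phi> = \<one>\<^bsub>cochain_group {{p}} G (Suc q)\<^esub>" if "\<phi> \<in> carrier (cochain_group {{p}} G (Suc q))" for \<phi>
  proof -
    let ?C = "chain_group {{p}} integer_group (Suc q)"
    have "\<phi> = (\<lambda>c\<in>carrier ?C. \<one>\<^bsub>G\<^esub>)"
    proof (rule extensionalityI[of _ "carrier ?C"])
      show "\<phi> \<in> extensional (carrier ?C)"
        using that by (simp add: mem_cochain_group)
      fix c assume c: "c \<in> carrier ?C"
      then have "\<phi> c = \<one>\<^bsub>G\<^esub>"
        using cochain_point_one[OF assms that] by (simp only: triv singleton_iff)
      then show "\<phi> c = (\<lambda>c\<in>carrier ?C. \<one>\<^bsub>G\<^esub>) c"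
        using c by simp
    qed simp
    then show ?thesis
      by (simp add: cochain_group_def)
  qed
  then show ?thesis
    unfolding group.trivial_group_subset[OF group_cochain_group_point[OF assms]] by blast
qed

text \<open>The coboundary composes with a boundary that is constantly the unit, and homomorphisms
  preserve the unit.\<close>

lemma coboundary_point:
  assumes "comm_group G" "\<phi> \<in> carrier (cochain_group {{p}} G q)"
  shows "coboundary {{p}} q \<phi> = \<one>\<^bsub>cochain_group {{p}} G (Suc q)\<^esub>"
  using cochain_point_one[OF assms]
  by (auto simp: coboundary_def boundary_point cochain_group_def intro!: restrict_ext)

lemma cocycle_group_point:
  "comm_group G \<Longrightarrow> cocycle_group {{p}} G q = cochain_group {{p}} G q"
  by (auto simp: cocycle_group_def kernel_def coboundary_point intro!: monoid.equality)

lemma coboundaries_point: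
  assumes "comm_group G"
  shows "coboundaries {{p}} G q = {\<one>\<^bsub>cochain_group {{p}} G q\<^esub>}"
proof (cases q)
  case (Suc m)
  have "coboundary {{p}} m ` carrier (cochain_group {{p}} G m) =
      (\<lambda>_. \<one>\<^bsub>cochain_group {{p}} G q\<^esub>) ` carrier (cochain_group {{p}} G m)"
    unfolding Suc by (rule image_cong[OF refl]) (rule coboundary_point[OF assms])
  also have "\<dots> = {\<one>\<^bsub>cochain_group {{p}} G q\<^esub>}"
    \<comment> \<open>The image of a constant map is a singleton only over a nonempty domain; the
      unit cochain is the witness.\<close>
    by (rule image_constant) (rule monoid.one_closed[OF group.is_monoid[OF group_cochain_group_point[OF assms]]])
  finally show ?thesis
    by (simp add: coboundaries_def Suc)
qed (simp add: coboundaries_def)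

lemma simplicial_cohomology_point:
  assumes "comm_group G"
  shows "group (simplicial_cohomology {{p}} G q)"
    "simplicial_cohomology {{p}} G q \<cong> cochain_group {{p}} G q"
  using group_Mod_one[OF group_cochain_group_point[OF assms]]
  by (simp_all add: simplicial_cohomology_def cocycle_group_point coboundaries_point assms)

lemma cohomology_restriction_point:
  assumes "comm_group G" "A \<in> carrier (simplicial_cohomology {{p}} G q)"
  shows "cohomology_restriction {{p}} {{p}} G q A = A"
  unfolding cohomology_restriction_def
proof (rule quotient_map_id)
  show "coboundaries {{p}} G q \<lhd> cocycle_group {{p}} G q"
    using group.one_is_normal[OF group_cochain_group_point[OF assms(1)]]
    by (simp add: coboundaries_point cocycle_group_point assms(1))
  show "A \<in> carrier (cocycle_group {{p}} G q Mod coboundaries {{p}} G q)"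
    using assms(2) by (simp add: simplicial_cohomology_def)
  fix \<phi> assume "\<phi> \<in> carrier (cocycle_group {{p}} G q)"
  then have "\<phi> \<in> extensional (carrier (chain_group {{p}} integer_group q))"
    using assms(1) by (simp add: cocycle_group_point mem_cochain_group)
  then show "(\<lambda>c\<in>carrier (chain_group {{p}} integer_group q).
      \<phi> (chain_inclusion {{p}} {{p}} integer_group q c)) = \<phi>"
    by - (rule extensionalityI[of _ "carrier (chain_group {{p}} integer_group q)"],
        simp_all add: chain_inclusion_point)
qed


section \<open>The one-point semi-uniform space\<close>

text \<open>The square of a point has only two subsets, and the empty one is excluded from the
  filter.\<close>

lemma semi_uniform_structure_point:
  assumes "semi_uniform_structure {p} F"
  shows "F = {{(p, p)}}"
proof -
  have "F \<subseteq> {{}, {(p, p)}}" "F \<noteq> {}" "{} \<notin> F"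
    using assms unfolding semi_uniform_structure_def by blast+
  then show ?thesis
    by blast
qed

text \<open>The ordering condition is vacuous on a one-element list, so the complex is the same for
  every \<open>U\<close>.\<close>

lemma VR_complex_point: "VR_complex {p} U = {{p}}"
proof -
  have "K = {p}" if K: "K \<in> VR_complex {p} U" for K
  proof -
    obtain xs where "K = set xs" "xs \<noteq> []" "set xs \<subseteq> {p}"
      using K unfolding VR_complex_def by blast
    then show ?thesis
      by (cases xs) auto
  qed
  moreover have "{p} \<in> VR_complex {p} U"
    unfolding VR_complex_def by (intro CollectI exI[of _ "[p]"]) simp
  ultimately show ?thesis
    by blast
qed

theorem theorem4p6:
  fixes p :: 'a and F :: "('a \<times> 'a) set set" and G :: "'g monoid" and n :: nat
  assumes "semi_uniform_structure {p} F" and "comm_group G"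
  shows "VR_homology {p} F G n \<cong> VR_cohomology {p} F G n \<and>
         VR_cohomology {p} F G n \<cong> (if n = 0 then G else singleton_group \<one>\<^bsub>G\<^esub>)"
proof -
  \<comment> \<open>Homology and cohomology are each identified with this common target and then
    compared through it.\<close>
  let ?T = "if n = 0 then G else singleton_group \<one>\<^bsub>G\<^esub>"
  have G: "group G"
    using assms(2) by (rule comm_group.axioms)
  have chain: "chain_group {{p}} G n \<cong> ?T"
  proof (cases n)
    case 0
    then show ?thesis
      using chain_group_point_0[OF G] by simp
  next
    case (Suc m)
    then show ?thesis
      using trivial_groups_iso[OF trivial_chain_group_point_Suc[OF G] trivial_singleton_group] by simp
  qed
  have cochain: "cochain_group {{p}} G n \<cong> ?T"
  proof (cases n)
    case 0
    then show ?thesis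
      using cochain_group_point_0[OF assms(2)] by simp
  next
    case (Suc m)
    then show ?thesis
      using trivial_groups_iso[OF trivial_cochain_group_point_Suc[OF assms(2)] trivial_singleton_group]
      by simp
  qed
  have "VR_homology {p} F G n \<cong> simplicial_homology {{p}} G n"
    unfolding VR_homology_def VR_complex_point semi_uniform_structure_point[OF assms(1)]
    by (rule inverse_limit_singleton) (rule homology_inclusion_point[OF G])
  also have "\<dots> \<cong> chain_group {{p}} G n"
    by (rule simplicial_homology_point[OF G])
  also note chain
  finally have homology: "VR_homology {p} F G n \<cong> ?T" .
  have VR: "group (VR_cohomology {p} F G n)"
    "VR_cohomology {p} F G n \<cong> simplicial_cohomology {{p}} G n"
    unfolding VR_cohomology_def VR_complex_point semi_uniform_structure_point[OF assms(1)]
    by (rule direct_limit_singleton,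
        rule simplicial_cohomology_point(1)[OF assms(2)],
        erule cohomology_restriction_point[OF assms(2)])+
  note VR(2)
  also have "simplicial_cohomology {{p}} G n \<cong> cochain_group {{p}} G n"
    by (rule simplicial_cohomology_point(2)[OF assms(2)])
  also note cochain
  finally have cohomology: "VR_cohomology {p} F G n \<cong> ?T" .
  then show ?thesis
    \<comment> \<open>Symmetry of isomorphism is applied on the cohomology side, which is where
      \<open>VR(1)\<close> enters.\<close>
    using iso_trans[OF homology group.iso_sym[OF VR(1)]] by blast
qed

end
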